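(* Let $X$ be a non-empty Lindelöf locally compact Hausdorff space, let $\mathcal{I}$ be a Riesz ideal of $C(X)$, let $(g_n)_{n\in\mathbb{N}}$ be a sequence in $\mathcal{I}$ and $\hat g\in\mathcal{I}$. Then the following two statements are equivalent: (1) The sequence $(g_n)_{n\in\mathbb{N}}$ is strictly $\mathcal{I}$-convergent to $\hat g$. (2) There exists an element $b\in\mathcal{I}^+$ such that $|g_n|\le b$ holds for all $n\in\mathbb{N}$, and $(g_n)_{n\in\mathbb{N}}$ converges to $\hat g$ with respect to the locally convex topology of uniform convergence on all compact subsets of $X$.
   Context: $\mathbb{N}=\{1,2,3,\dots\}$. $C(X)$ is the space of real-valued continuous functions on $X$ with pointwise operations and pointwise order; $|f|$ is the pointwise absolute value. A Riesz ideal of $C(X)$ is a linear subspace $\mathcal{I}\subseteq C(X)$ such that $f\in C(X)$, $g\in\mathcal{I}$ and $|f|\le|g|$ imply $f\in\mathcal{I}$; $\mathcal{I}^+$ denotes the set of functions in $\mathcal{I}$ that are $\ge 0$. A decreasing sequence $(f_k)_{k\in\mathbb{N}}$ in $\mathcal{I}$ has pointwise infimum $0$ if $\inf_{k} f_k(x)=0$ for all $x\in X$. A sequence $(g_n)_{n\in\mathbb{N}}$ in $\mathcal{I}$ is strictly $\mathcal{I}$-convergent to $\hat g\in\mathcal{I}$ if there exists a decreasing sequence $(f_k)_{k\in\mathbb{N}}$ in $\mathcal{I}$ with pointwise infimum $0$ such that for all $k\in\mathbb{N}$ there is $N\in\mathbb{N}$ with $|\hat g-g_n|\le f_k$ for all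 $n\ge N$. *)

theory Defs
  imports "HOL-Analysis.Analysis"
begin

(* Functions on the space X are represented extensionally (value "undefined" outside
   topspace X), so that two elements of C(X) are equal iff they agree on X. The pointwise
   operations are therefore written with restricted lambda abstractions. *)
definition cont_funs :: "'a topology \<Rightarrow> ('a \<Rightarrow> real) set" where
  "cont_funs X = {f \<in> extensional (topspace X). continuous_map X euclideanreal f}"

definition riesz_ideal :: "'a topology \<Rightarrow> ('a \<Rightarrow> real) set \<Rightarrow> bool" where
  "riesz_ideal X I \<longleftrightarrow>
     I \<subseteq> cont_funs X \<and>
     (\<lambda>x\<in>topspace X. 0) \<in> I \<and>
     (\<forall>f\<in>I. \<forall>g\<in>I. (\<lambda>x\<in>topspace X. f x + g x) \<in> I) \<and>
     (\<forall>c. \<forall>f\<in>I. (\<lambda>x\<in>topspace X. c * f x) \<in> I) \<and>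
     (\<forall>f\<in>cont_funs X. \<forall>g\<in>I. (\<forall>x\<in>topspace X. \<bar>f x\<bar> \<le> \<bar>g x\<bar>) \<longrightarrow> f \<in> I)"

definition nonneg_part :: "'a topology \<Rightarrow> ('a \<Rightarrow> real) set \<Rightarrow> ('a \<Rightarrow> real) set" where
  "nonneg_part X I = {f \<in> I. \<forall>x\<in>topspace X. 0 \<le> f x}"

definition decreasing_funs :: "'a topology \<Rightarrow> (nat \<Rightarrow> 'a \<Rightarrow> real) \<Rightarrow> bool" where
  "decreasing_funs X f \<longleftrightarrow> (\<forall>x\<in>topspace X. decseq (\<lambda>k. f k x))"

(* INF on the reals is only meaningful for sets that are bounded below. *)
definition pointwise_inf_zero :: "'a topology \<Rightarrow> (nat \<Rightarrow> 'a \<Rightarrow> real) \<Rightarrow> bool" where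
  "pointwise_inf_zero X f \<longleftrightarrow>
     (\<forall>x\<in>topspace X. bdd_below (range (\<lambda>k. f k x)) \<and> (INF k. f k x) = 0)"

definition strictly_convergent ::
  "'a topology \<Rightarrow> ('a \<Rightarrow> real) set \<Rightarrow> (nat \<Rightarrow> 'a \<Rightarrow> real) \<Rightarrow> ('a \<Rightarrow> real) \<Rightarrow> bool" where
  "strictly_convergent X I g g' \<longleftrightarrow>
     (\<exists>f. (\<forall>k. f k \<in> I) \<and> decreasing_funs X f \<and> pointwise_inf_zero X f \<and>
          (\<forall>k. \<exists>N. \<forall>n\<ge>N. \<forall>x\<in>topspace X. \<bar>g' x - g n x\<bar> \<le> f k x))"

(* The locally convex topology on C(X) generated by the seminorms
   f \<mapsto> sup {|f x| | x \<in> K}, K compact: for compact K the set below is the open ball of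
   radius e around f for this seminorm, because the supremum is attained (and all of C(X)
   if K is empty). *)
definition compact_convergence_topology :: "'a topology \<Rightarrow> ('a \<Rightarrow> real) topology" where
  "compact_convergence_topology X =
     topology_generated_by
       {{h \<in> cont_funs X. \<forall>x\<in>K. \<bar>h x - f x\<bar> < e} | K f e.
          compactin X K \<and> f \<in> cont_funs X \<and> 0 < e}"

end

theory Submission
  imports Defs
begin

text \<open>
  Strict convergence is dominated convergence in which the dominating functions decrease to
  \<open>0\<close> pointwise, and the theorem says that this is the same as order boundedness together with
  locally uniform convergence.

  For the forward direction, a decreasing sequence of continuous functions with pointwise infimum
  \<open>0\<close> converges to \<open>0\<close> uniformly on every compact set by Dini's theorem
  (\<open>Dini_decreasing_to_zero\<close>), so the differences \<open>g' - g n\<close>, which each of its terms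
  eventually dominates, do the same. A tail of the sequence is bounded by \<open>\<bar>g'\<bar> + f 0\<close>, and each of the finitely many
  remaining terms is itself in the ideal.

  For the converse let \<open>b\<close> bound the sequence and therefore also its limit, so that
  \<open>\<bar>g' - g n\<bar> \<le> 2 b\<close> everywhere. Far out in \<open>X\<close> nothing better than \<open>2 b\<close> is known, while on
  a compact set the difference is eventually as small as desired. Hence one takes cut-off functions
  \<open>\<phi> k\<close> with values in \<open>[0,1]\<close> that equal \<open>1\<close> outside some compact set and decrease to \<open>0\<close> as \<open>k\<close>
  grows (\<open>vanishing_cutoffs\<close>; this is where local compactness and the Lindeloef property enter), and
  puts \<open>f k = 2 b \<phi> k + min (2 b) (1 / (k + 1))\<close>. Outside the compact set belonging to \<open>\<phi> k\<close> the
  first summand dominates all differences, inside it the second one does so eventually. Since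
  \<open>f k \<le> 4 b\<close>, the functions \<open>f k\<close> lie in the ideal.
\<close>

section \<open>Riesz ideals\<close>

lemma riesz_ideal_continuous:
  assumes "riesz_ideal X I" "f \<in> I"
  shows "continuous_map X euclideanreal f"
  using assms unfolding riesz_ideal_def cont_funs_def by blast

lemma restrict_in_cont_funs:
  assumes "continuous_map X euclideanreal f"
  shows "restrict f (topspace X) \<in> cont_funs X"
  using continuous_map_eq[OF assms, of "restrict f (topspace X)"]
  by (simp add: cont_funs_def)

lemma riesz_ideal_dominated:
  assumes I: "riesz_ideal X I" and "g \<in> I" and "continuous_map X euclideanreal f"
    and "\<And>x. x \<in> topspace X \<Longrightarrow> \<bar>f x\<bar> \<le> \<bar>g x\<bar>"
  shows "restrict f (topspace X) \<in> I"
proof -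
  have "\<forall>f\<in>cont_funs X. \<forall>g\<in>I. (\<forall>x\<in>topspace X. \<bar>f x\<bar> \<le> \<bar>g x\<bar>) \<longrightarrow> f \<in> I"
    using I by (simp add: riesz_ideal_def)
  moreover have "\<forall>x\<in>topspace X. \<bar>restrict f (topspace X) x\<bar> \<le> \<bar>g x\<bar>"
    using assms(4) by simp
  ultimately show ?thesis
    using restrict_in_cont_funs[OF assms(3)] assms(2) by blast
qed

lemma riesz_ideal_abs:
  assumes "riesz_ideal X I" "f \<in> I"
  shows "(\<lambda>x\<in>topspace X. \<bar>f x\<bar>) \<in> I"
  using riesz_ideal_dominated[OF assms continuous_map_real_abs[OF riesz_ideal_continuous[OF assms]]]
  by simp

lemma riesz_ideal_restrict:
  assumes "riesz_ideal X I" "f \<in> I"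
  shows "restrict f (topspace X) \<in> I"
  using riesz_ideal_dominated[OF assms riesz_ideal_continuous[OF assms]] by simp

text \<open>
  The membership conditions are on the restrictions, so that sums of arbitrary lambda terms can be
  handled summand by summand.
\<close>
lemma riesz_ideal_add:
  assumes "riesz_ideal X I" "restrict f (topspace X) \<in> I" "restrict g (topspace X) \<in> I"
  shows "(\<lambda>x\<in>topspace X. f x + g x) \<in> I"
proof -
  have "(\<lambda>x\<in>topspace X. f x + g x)
      = (\<lambda>x\<in>topspace X. restrict f (topspace X) x + restrict g (topspace X) x)"
    by (rule restrict_ext) simp
  also have "\<dots> \<in> I"
    using assms unfolding riesz_ideal_def by blast
  finally show ?thesis .
qed

lemma riesz_ideal_scale:
  assumes "riesz_ideal X I" "f \<in> I"
  shows "(\<lambda>x\<in>topspace X. c * f x) \<in> I"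
  using assms unfolding riesz_ideal_def by blast

lemma riesz_ideal_sum_abs:
  assumes I: "riesz_ideal X I" and g: "\<And>n. g n \<in> I"
  shows "(\<lambda>x\<in>topspace X. \<Sum>n<(N::nat). \<bar>g n x\<bar>) \<in> I"
proof (induction N)
  case 0
  then show ?case using I unfolding riesz_ideal_def lessThan_0 sum.empty by blast
next
  case (Suc N)
  show ?case
    unfolding sum.lessThan_Suc by (rule riesz_ideal_add[OF I Suc riesz_ideal_abs[OF I g]])
qed

section \<open>Decreasing sequences and Dini's theorem\<close>

lemma pointwise_inf_zero_nonneg:
  assumes "pointwise_inf_zero X f" "x \<in> topspace X"
  shows "0 \<le> f k x"
proof -
  have "bdd_below (range (\<lambda>k. f k x))" and "(INF k. f k x) = 0"
    using assms unfolding pointwise_inf_zero_def by auto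
  then show ?thesis
    using cINF_lower[of "\<lambda>k. f k x" UNIV k] by simp
qed

lemma pointwise_inf_zero_tendsto:
  assumes "decreasing_funs X f" "pointwise_inf_zero X f" "x \<in> topspace X"
  shows "(\<lambda>k. f k x) \<longlonglongrightarrow> 0"
proof -
  have "bdd_below (range (\<lambda>k. f k x))" "(INF k. f k x) = 0" "decseq (\<lambda>k. f k x)"
    using assms unfolding pointwise_inf_zero_def decreasing_funs_def by auto
  then show ?thesis
    using LIMSEQ_decseq_INF[of "\<lambda>k. f k x"] by simp
qed

lemma pointwise_inf_zeroI:
  assumes "decreasing_funs X f" "\<And>x k. x \<in> topspace X \<Longrightarrow> 0 \<le> f k x"
    and "\<And>x. x \<in> topspace X \<Longrightarrow> (\<lambda>k. f k x) \<longlonglongrightarrow> 0"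
  shows "pointwise_inf_zero X f"
  unfolding pointwise_inf_zero_def
proof (intro ballI conjI)
  fix x assume x: "x \<in> topspace X"
  show bdd: "bdd_below (range (\<lambda>k. f k x))"
    using assms(2)[OF x] by (intro bdd_belowI[of _ 0]) auto
  have "(\<lambda>k. f k x) \<longlonglongrightarrow> (INF k. f k x)"
    using assms(1) x bdd by (intro LIMSEQ_decseq_INF) (auto simp: decreasing_funs_def)
  then show "(INF k. f k x) = 0"
    using assms(3)[OF x] LIMSEQ_unique by blast
qed

text \<open>
  The open sets \<open>{x. f k x < e}\<close> increase with \<open>k\<close> and cover the space, so a single one of them
  already contains the compact set.
\<close>
lemma Dini_decreasing_to_zero:
  assumes "decreasing_funs X f" and lim: "\<And>x. x \<in> topspace X \<Longrightarrow> (\<lambda>k. f k x) \<longlonglongrightarrow> 0"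
    and cont: "\<And>k. continuous_map X euclideanreal (f k)"
    and K: "compactin X K" and "0 < e"
  shows "\<exists>k. \<forall>x\<in>K. f k x < e"
proof -
  define U where "U k = {x \<in> topspace X. f k x < e}" for k
  have mono: "U j \<subseteq> U k" if "j \<le> k" for j k
    using assms(1) that unfolding U_def decreasing_funs_def decseq_def
    by (auto intro: le_less_trans)
  have "openin X (U k)" for k
    using cont[of k] unfolding U_def continuous_map_upper_lower_semicontinuous_lt by blast
  moreover have "K \<subseteq> \<Union>(range U)"
  proof
    fix x assume "x \<in> K"
    then have x: "x \<in> topspace X"
      using K compactin_subset_topspace by blast
    have "\<forall>\<^sub>F k in sequentially. f k x < e"
      using lim[OF x] \<open>0 < e\<close> by (simp add: order_tendsto_iff)
    then show "x \<in> \<Union>(range U)"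
      using x unfolding U_def eventually_sequentially by blast
  qed
  ultimately obtain \<F> where \<F>: "finite \<F>" "\<F> \<subseteq> range U" "K \<subseteq> \<Union>\<F>"
    using compactinD[OF K, of "range U"] by blast
  then obtain J where "finite J" "\<F> = U ` J"
    by (meson finite_subset_image)
  have "U j \<subseteq> U (Max (insert 0 J))" if "j \<in> J" for j
    using \<open>finite J\<close> that by (intro mono) simp
  then have "K \<subseteq> U (Max (insert 0 J))"
    using \<F>(3) \<open>\<F> = U ` J\<close> by blast
  then show ?thesis
    unfolding U_def by blast
qed

section \<open>Convergence in the topology of compact convergence\<close>

text \<open>
  Convergence only has to be tested on a subbase, since eventuality is stable under finite
  intersections.
\<close>
lemma limitin_topology_generated_by:
  "limitin (topology_generated_by \<S>) f l F \<longleftrightarrow>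
     l \<in> \<Union>\<S> \<and> (\<forall>S\<in>\<S>. l \<in> S \<longrightarrow> (\<forall>\<^sub>F n in F. f n \<in> S))"
proof
  assume L: "limitin (topology_generated_by \<S>) f l F"
  then have "l \<in> \<Union>\<S>"
    by (simp add: limitin_def)
  moreover have "\<forall>\<^sub>F n in F. f n \<in> S" if "S \<in> \<S>" "l \<in> S" for S
    using L that topology_generated_by_Basis[OF that(1)] unfolding limitin_def by blast
  ultimately show "l \<in> \<Union>\<S> \<and> (\<forall>S\<in>\<S>. l \<in> S \<longrightarrow> (\<forall>\<^sub>F n in F. f n \<in> S))"
    by blast
next
  assume R: "l \<in> \<Union>\<S> \<and> (\<forall>S\<in>\<S>. l \<in> S \<longrightarrow> (\<forall>\<^sub>F n in F. f n \<in> S))"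
  have "\<forall>\<^sub>F n in F. f n \<in> U" if "generate_topology_on \<S> U" "l \<in> U" for U
    using that
  proof induction
    case (Int U V)
    then show ?case by (simp add: eventually_conj)
  next
    case (UN \<U>)
    then obtain V where "V \<in> \<U>" "\<forall>\<^sub>F n in F. f n \<in> V"
      by blast
    then show ?case by (auto elim: eventually_mono)
  qed (use R in blast)+
  then show "limitin (topology_generated_by \<S>) f l F"
    using R by (simp add: limitin_def openin_topology_generated_by_iff)
qed

text \<open>
  A subbasic set is a ball around an arbitrary centre \<open>f\<close>, not necessarily around the limit.
  It contains a ball of the same seminorm around each of its points, because a continuous function
  attains its maximum on a compact set.
\<close>
lemma limitin_compact_convergence_topology_iff:
  assumes g: "\<And>n. g n \<in> cont_funs X" and g': "g' \<in> cont_funs X"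
  shows "limitin (compact_convergence_topology X) g g' F \<longleftrightarrow>
    (\<forall>K e. compactin X K \<longrightarrow> 0 < e \<longrightarrow> (\<forall>\<^sub>F n in F. \<forall>x\<in>K. \<bar>g n x - g' x\<bar> < e))"
    (is "?L \<longleftrightarrow> ?R")
proof -
  define B where "B K f e = {h \<in> cont_funs X. \<forall>x\<in>K. \<bar>h x - f x\<bar> < e}" for K f and e :: real
  define \<S> where "\<S> = {B K f e | K f e. compactin X K \<and> f \<in> cont_funs X \<and> 0 < e}"
  have B_in: "B K f e \<in> \<S>" if "compactin X K" "f \<in> cont_funs X" "0 < e" for K f e
    unfolding \<S>_def using that by blast
  have L: "?L \<longleftrightarrow> g' \<in> \<Union>\<S> \<and> (\<forall>S\<in>\<S>. g' \<in> S \<longrightarrow> (\<forall>\<^sub>F n in F. g n \<in> S))"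
    unfolding compact_convergence_topology_def B_def[symmetric] \<S>_def[symmetric]
    by (rule limitin_topology_generated_by)
  show ?thesis
  proof
    assume ?L
    show ?R
    proof (intro allI impI)
      fix K and e :: real
      assume "compactin X K" "0 < e"
      moreover from this have "g' \<in> B K g' e"
        using g' by (simp add: B_def)
      ultimately have "\<forall>\<^sub>F n in F. g n \<in> B K g' e"
        using \<open>?L\<close> L B_in[OF _ g'] by blast
      then show "\<forall>\<^sub>F n in F. \<forall>x\<in>K. \<bar>g n x - g' x\<bar> < e"
        by (rule eventually_mono) (simp add: B_def)
    qed
  next
    assume R: ?R
    show ?L
      unfolding L
    proof (intro conjI ballI impI)
      have "g' \<in> B {} g' 1"
        using g' by (simp add: B_def)
      then show "g' \<in> \<Union>\<S>"
        using B_in[of "{}" g' 1] g' by auto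
    next
      fix S assume "S \<in> \<S>" and "g' \<in> S"
      then obtain K f e where K: "compactin X K" and f: "f \<in> cont_funs X" and S: "S = B K f e"
        unfolding \<S>_def by blast
      have less: "\<bar>g' x - f x\<bar> < e" if "x \<in> K" for x
        using \<open>g' \<in> S\<close> that by (simp add: S B_def)
      have "continuous_map X euclideanreal (\<lambda>x. \<bar>g' x - f x\<bar>)"
        using f g' by (intro continuous_intros) (auto simp: cont_funs_def)
      then have comp: "compact ((\<lambda>x. \<bar>g' x - f x\<bar>) ` K)"
        using image_compactin[OF K] compactin_euclidean_iff by blast
      obtain d where d: "0 < d" "\<And>x. x \<in> K \<Longrightarrow> \<bar>g' x - f x\<bar> + d \<le> e"
      proof (cases "K = {}")
        case True
        then show ?thesis using that[of 1] by simp
      next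
        case False
        then obtain z where "z \<in> K" "\<And>x. x \<in> K \<Longrightarrow> \<bar>g' x - f x\<bar> \<le> \<bar>g' z - f z\<bar>"
          using compact_attains_sup[OF comp] by auto
        then show ?thesis
          using that[of "e - \<bar>g' z - f z\<bar>"] less[of z] by simp
      qed
      have "\<forall>\<^sub>F n in F. \<forall>x\<in>K. \<bar>g n x - g' x\<bar> < d"
        using R K d(1) by blast
      then show "\<forall>\<^sub>F n in F. g n \<in> S"
      proof eventually_elim
        case (elim n)
        have "\<bar>g n x - f x\<bar> < e" if "x \<in> K" for x
          using elim[rule_format, OF that] d(2)[OF that] by linarith
        then show ?case using g by (simp add: S B_def)
      qed
    qed
  qed
qed

section \<open>Cut-off functions\<close>

text \<open>
  Around each point there is a continuous function \<open>\<psi> x \<ge> 0\<close> that is positive at \<open>x\<close> and vanishes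
  outside a compact set. By the Lindeloef property the positivity sets of countably many of them,
  \<open>\<psi> (c 0), \<psi> (c 1), \<dots>\<close>, cover the space. The factor \<open>k\<close> in
  \<open>1 - min 1 (k * (\<Sum>j<k. \<psi> (c j) x))\<close> makes the minimum reach \<open>1\<close> eventually at each \<open>x\<close>, while the
  sum vanishes outside the union of the first \<open>k\<close> compact sets.
\<close>
lemma vanishing_cutoffs:
  assumes ne: "topspace X \<noteq> {}" and Lin: "Lindelof_space X"
    and lc: "locally_compact_space X" and H: "Hausdorff_space X"
  obtains \<phi> :: "nat \<Rightarrow> 'a \<Rightarrow> real" where
    "\<And>k. continuous_map X euclideanreal (\<phi> k)"
    "\<And>k x. 0 \<le> \<phi> k x" "\<And>k x. \<phi> k x \<le> 1"
    "\<And>x. decseq (\<lambda>k. \<phi> k x)"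
    "\<And>x. x \<in> topspace X \<Longrightarrow> \<forall>\<^sub>F k in sequentially. \<phi> k x = 0"
    "\<And>k. \<exists>K. compactin X K \<and> (\<forall>x\<in>topspace X - K. \<phi> k x = 1)"
proof -
  have reg: "completely_regular_space X"
    using lc H by (intro locally_compact_regular_imp_completely_regular_space
        locally_compact_Hausdorff_imp_regular_space) auto
  define bump where "bump x \<psi> K \<longleftrightarrow> continuous_map X euclideanreal \<psi> \<and> (\<forall>y. 0 \<le> \<psi> y) \<and>
      0 < \<psi> x \<and> compactin X K \<and> (\<forall>y\<in>topspace X - K. \<psi> y = 0)"
    for x and \<psi> :: "'a \<Rightarrow> real" and K
  have "\<exists>\<psi> K. bump x \<psi> K" if x: "x \<in> topspace X" for x
  proof -
    obtain U K where U: "openin X U" "compactin X K" "x \<in> U" "U \<subseteq> K"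
      using lc x unfolding locally_compact_space_def by blast
    have "\<exists>f. continuous_map X euclideanreal f \<and> f x = 1 \<and> f ` (topspace X - U) \<subseteq> {0}"
      using completely_regular_space_gen_alt'[OF one_neq_zero, THEN iffD1, OF reg,
          THEN spec, THEN spec, THEN mp, THEN mp, OF U(1,3)] .
    then obtain f where f: "continuous_map X euclideanreal f" "f x = 1"
        "f ` (topspace X - U) \<subseteq> {0::real}"
      by blast
    have "continuous_map X euclideanreal (\<lambda>y. max 0 (f y))"
      by (intro continuous_map_real_max f(1)) simp
    moreover have "\<forall>y\<in>topspace X - K. max 0 (f y) = 0"
    proof
      fix y assume "y \<in> topspace X - K"
      then have "f y \<in> f ` (topspace X - U)"
        using U(4) by blast
      then show "max 0 (f y) = 0"
        using f(3) by auto
    qed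
    ultimately show ?thesis
      unfolding bump_def using U(2) f(2)
      by (intro exI[of _ "\<lambda>y. max 0 (f y)"] exI[of _ K] conjI allI) simp_all
  qed
  then obtain \<psi> K where "\<And>x. x \<in> topspace X \<Longrightarrow> bump x (\<psi> x) (K x)"
    by metis
  then have \<psi>: "\<And>x. x \<in> topspace X \<Longrightarrow> continuous_map X euclideanreal (\<psi> x)"
      "\<And>x y. x \<in> topspace X \<Longrightarrow> 0 \<le> \<psi> x y" "\<And>x. x \<in> topspace X \<Longrightarrow> 0 < \<psi> x x"
    and K: "\<And>x. x \<in> topspace X \<Longrightarrow> compactin X (K x)"
      "\<And>x y. x \<in> topspace X \<Longrightarrow> y \<in> topspace X - K x \<Longrightarrow> \<psi> x y = 0"
    unfolding bump_def by blast+
  define V where "V x = {y \<in> topspace X. 0 < \<psi> x y}" for x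
  have "\<forall>U\<in>V ` topspace X. openin X U"
    using \<psi>(1) unfolding V_def continuous_map_upper_lower_semicontinuous_lt by simp
  moreover have "\<Union>(V ` topspace X) = topspace X"
    using \<psi>(3) by (auto simp: V_def)
  ultimately have "\<exists>\<V>. countable \<V> \<and> \<V> \<subseteq> V ` topspace X \<and> \<Union>\<V> = topspace X"
    using Lin[unfolded Lindelof_space_def, THEN spec, THEN mp, OF conjI] by simp
  then have "\<exists>C. countable C \<and> C \<subseteq> topspace X \<and> \<Union>(V ` C) = topspace X"
    unfolding ex_countable_subset_image .
  then obtain C where C: "countable C" "C \<subseteq> topspace X" and cov: "\<Union>(V ` C) = topspace X"
    by (elim exE conjE)
  then have "C \<noteq> {}"
    using ne unfolding cov[symmetric] by blast
  then obtain c :: "nat \<Rightarrow> 'a" where c: "range c = C"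
    using that[OF range_from_nat_into[OF _ C(1)]] by simp
  have cX: "c j \<in> topspace X" for j
    using c C(2) by blast
  define s where "s k x = real k * (\<Sum>j<k. \<psi> (c j) x)" for k x
  have s_nonneg: "0 \<le> s k x" for k x
    unfolding s_def by (simp add: sum_nonneg \<psi>(2)[OF cX])
  have s_mono: "s k x \<le> s l x" if "k \<le> l" for k l x
    unfolding s_def
    by (intro mult_mono sum_mono2) (use that in \<open>auto simp: sum_nonneg \<psi>(2)[OF cX]\<close>)
  show thesis
  proof (rule that[of "\<lambda>k x. 1 - min 1 (s k x)"])
    show "continuous_map X euclideanreal (\<lambda>x. 1 - min 1 (s k x))" for k
      unfolding s_def
      by (intro continuous_map_diff continuous_map_real_min continuous_map_real_mult_left
          continuous_map_sum \<psi>(1)[OF cX]) simp_all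
    show "0 \<le> 1 - min 1 (s k x)" "1 - min 1 (s k x) \<le> 1" for k x
      using s_nonneg[of k x] by auto
    show "decseq (\<lambda>k. 1 - min 1 (s k x))" for x
      unfolding decseq_def by (intro allI impI diff_left_mono min.mono order_refl s_mono)
    show "\<forall>\<^sub>F k in sequentially. 1 - min 1 (s k x) = 0" if x: "x \<in> topspace X" for x
    proof -
      have "x \<in> (\<Union>j. V (c j))"
        using x cov c by (metis image_image)
      then obtain j where j: "0 < \<psi> (c j) x"
        by (auto simp: V_def)
      obtain m :: nat where m: "1 < real m * \<psi> (c j) x"
        using ex_less_of_nat_mult[OF j] by blast
      have "1 \<le> s k x" if k: "k \<ge> max m (Suc j)" for k
      proof -
        have "\<psi> (c j) x \<le> (\<Sum>j<k. \<psi> (c j) x)"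
          using k by (intro member_le_sum) (auto simp: \<psi>(2)[OF cX])
        then have "real m * \<psi> (c j) x \<le> s k x"
          unfolding s_def using k j by (intro mult_mono) auto
        then show ?thesis using m by linarith
      qed
      then show ?thesis
        by (intro eventually_sequentiallyI[of "max m (Suc j)"]) simp
    qed
    show "\<exists>L. compactin X L \<and> (\<forall>x\<in>topspace X - L. 1 - min 1 (s k x) = 1)" for k
    proof (intro exI conjI ballI)
      show "compactin X (\<Union>j<k. K (c j))"
        using K(1)[OF cX] by (intro compactin_Union) auto
      fix x assume "x \<in> topspace X - (\<Union>j<k. K (c j))"
      then have "s k x = 0"
        unfolding s_def using K(2)[OF cX] by simp
      then show "1 - min 1 (s k x) = 1" by simp
    qed
  qed
qed

section \<open>The characterisation of strict convergence\<close>

lemma strictly_convergent_imp_bounded: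
  assumes I: "riesz_ideal X I" and g: "\<And>n. g n \<in> I" and g': "g' \<in> I"
    and sc: "strictly_convergent X I g g'"
  shows "\<exists>b\<in>nonneg_part X I. \<forall>n. \<forall>x\<in>topspace X. \<bar>g n x\<bar> \<le> b x"
proof -
  obtain f where f: "\<And>k. f k \<in> I" "pointwise_inf_zero X f"
      "\<And>k. \<exists>N. \<forall>n\<ge>N. \<forall>x\<in>topspace X. \<bar>g' x - g n x\<bar> \<le> f k x"
    using sc unfolding strictly_convergent_def by blast
  obtain N where N: "\<And>n x. n \<ge> N \<Longrightarrow> x \<in> topspace X \<Longrightarrow> \<bar>g' x - g n x\<bar> \<le> f 0 x"
    using f(3)[of 0] by blast
  define b where "b = (\<lambda>x\<in>topspace X. (\<bar>g' x\<bar> + f 0 x) + (\<Sum>n<N. \<bar>g n x\<bar>))"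
  have "b \<in> I"
    unfolding b_def
    by (intro riesz_ideal_add[OF I] riesz_ideal_abs[OF I] riesz_ideal_restrict[OF I]
        riesz_ideal_sum_abs[OF I] g g' f(1))
  have f0: "0 \<le> f 0 x" if "x \<in> topspace X" for x
    using pointwise_inf_zero_nonneg[OF f(2) that] .
  have sum0: "0 \<le> (\<Sum>n<N. \<bar>g n x\<bar>)" for x
    by (simp add: sum_nonneg)
  have "0 \<le> b x" if "x \<in> topspace X" for x
    using f0[OF that] sum0[of x] that by (simp add: b_def)
  moreover have "\<bar>g n x\<bar> \<le> b x" if x: "x \<in> topspace X" for n x
  proof (cases "n < N")
    case True
    then have "\<bar>g n x\<bar> \<le> (\<Sum>n<N. \<bar>g n x\<bar>)"
      by (intro member_le_sum) auto
    then show ?thesis using f0[OF x] x by (simp add: b_def)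
  next
    case False
    then have "\<bar>g n x\<bar> \<le> (\<bar>g' x\<bar> + f 0 x) + (\<Sum>n<N. \<bar>g n x\<bar>)"
      using N[of n x] x sum0[of x] by linarith
    then show ?thesis using x by (simp add: b_def)
  qed
  ultimately show ?thesis
    using \<open>b \<in> I\<close> unfolding nonneg_part_def by blast
qed

lemma strictly_convergent_imp_compact_convergence:
  assumes I: "riesz_ideal X I" and g: "\<And>n. g n \<in> I" and g': "g' \<in> I"
    and sc: "strictly_convergent X I g g'"
  shows "limitin (compact_convergence_topology X) g g' sequentially"
proof -
  have sub: "I \<subseteq> cont_funs X"
    using I by (simp add: riesz_ideal_def)
  have C: "\<And>n. g n \<in> cont_funs X" "g' \<in> cont_funs X"
    using g g' sub by auto
  obtain f where f: "\<And>k. f k \<in> I" "decreasing_funs X f" "pointwise_inf_zero X f"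
      "\<And>k. \<exists>N. \<forall>n\<ge>N. \<forall>x\<in>topspace X. \<bar>g' x - g n x\<bar> \<le> f k x"
    using sc unfolding strictly_convergent_def by blast
  show ?thesis
    unfolding limitin_compact_convergence_topology_iff[OF C]
  proof (intro allI impI)
    fix K and e :: real
    assume K: "compactin X K" and "0 < e"
    then obtain k where k: "\<forall>x\<in>K. f k x < e"
      using Dini_decreasing_to_zero[OF f(2) pointwise_inf_zero_tendsto[OF f(2,3)]
          riesz_ideal_continuous[OF I f(1)]] by blast
    obtain N where N: "\<And>n x. n \<ge> N \<Longrightarrow> x \<in> topspace X \<Longrightarrow> \<bar>g' x - g n x\<bar> \<le> f k x"
      using f(4)[of k] by blast
    have "\<bar>g n x - g' x\<bar> < e" if "n \<ge> N" "x \<in> K" for n x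
    proof -
      have "x \<in> topspace X"
        using K that(2) compactin_subset_topspace by blast
      then show ?thesis
        using N[of n x] k that by (force simp: abs_minus_commute)
    qed
    then show "\<forall>\<^sub>F n in sequentially. \<forall>x\<in>K. \<bar>g n x - g' x\<bar> < e"
      unfolding eventually_sequentially by blast
  qed
qed

lemma bounded_compact_convergence_imp_strictly_convergent:
  assumes "topspace X \<noteq> {}" "Lindelof_space X" "locally_compact_space X" "Hausdorff_space X"
    and I: "riesz_ideal X I" and g: "\<And>n. g n \<in> I" and g': "g' \<in> I"
    and b: "b \<in> nonneg_part X I" "\<And>n x. x \<in> topspace X \<Longrightarrow> \<bar>g n x\<bar> \<le> b x"
    and lim: "limitin (compact_convergence_topology X) g g' sequentially"
  shows "strictly_convergent X I g g'"
proof -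
  have sub: "I \<subseteq> cont_funs X"
    using I by (simp add: riesz_ideal_def)
  have C: "\<And>n. g n \<in> cont_funs X" "g' \<in> cont_funs X"
    using g g' sub by auto
  have unif: "\<forall>\<^sub>F n in sequentially. \<forall>x\<in>K. \<bar>g n x - g' x\<bar> < e" if "compactin X K" "0 < e" for K e
    using lim that unfolding limitin_compact_convergence_topology_iff[OF C] by blast
  have bI: "b \<in> I" and b0: "\<And>x. x \<in> topspace X \<Longrightarrow> 0 \<le> b x"
    using b(1) unfolding nonneg_part_def by auto
  have g'_le: "\<bar>g' x\<bar> \<le> b x" if x: "x \<in> topspace X" for x
  proof (rule field_le_epsilon)
    fix e :: real assume "0 < e"
    \<comment> \<open>Points are compact, so compact convergence implies pointwise convergence.\<close>
    then have "\<forall>\<^sub>F n in sequentially. \<bar>g n x - g' x\<bar> < e"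
      using unif[of "{x}" e] x by simp
    then obtain n where "\<bar>g n x - g' x\<bar> < e"
      using eventually_happens'[OF sequentially_bot] by blast
    then show "\<bar>g' x\<bar> \<le> b x + e"
      using b(2)[OF x, of n] by linarith
  qed
  have diff: "\<bar>g' x - g n x\<bar> \<le> 2 * b x" if "x \<in> topspace X" for n x
    using b(2)[OF that, of n] g'_le[OF that] by linarith
  obtain \<phi> :: "nat \<Rightarrow> 'a \<Rightarrow> real" where \<phi>:
    "\<And>k. continuous_map X euclideanreal (\<phi> k)"
    "\<And>k x. 0 \<le> \<phi> k x" "\<And>k x. \<phi> k x \<le> 1"
    "\<And>x. decseq (\<lambda>k. \<phi> k x)"
    "\<And>x. x \<in> topspace X \<Longrightarrow> \<forall>\<^sub>F k in sequentially. \<phi> k x = 0"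
    "\<And>k. \<exists>K. compactin X K \<and> (\<forall>x\<in>topspace X - K. \<phi> k x = 1)"
    using vanishing_cutoffs[OF assms(1-4)] by blast
  define F where "F k x = 2 * b x * \<phi> k x + min (2 * b x) (1 / real (Suc k))" for k x
  define f where "f k = restrict (F k) (topspace X)" for k
  have F_nonneg: "0 \<le> F k x" if "x \<in> topspace X" for k x
    unfolding F_def using b0[OF that] \<phi>(2)[of k x] by simp
  have dec: "decreasing_funs X f"
    unfolding decreasing_funs_def decseq_def
  proof (intro ballI allI impI)
    fix x and m n :: nat
    assume x: "x \<in> topspace X" and mn: "m \<le> n"
    have "2 * b x * \<phi> n x \<le> 2 * b x * \<phi> m x"
      using \<phi>(4)[of x] mn b0[OF x] by (intro mult_left_mono) (auto simp: decseq_def)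
    moreover have "1 / real (Suc n) \<le> 1 / real (Suc m)"
      using mn by (intro divide_left_mono) auto
    ultimately show "f n x \<le> f m x"
      using x unfolding f_def F_def by (auto simp: min_def)
  qed
  have "(\<lambda>k. f k x) \<longlonglongrightarrow> 0" if x: "x \<in> topspace X" for x
  proof (rule tendsto_sandwich[OF _ _ tendsto_const LIMSEQ_inverse_real_of_nat])
    show "\<forall>\<^sub>F k in sequentially. 0 \<le> f k x"
      using F_nonneg[OF x] x by (simp add: f_def)
    show "\<forall>\<^sub>F k in sequentially. f k x \<le> inverse (real (Suc k))"
      using \<phi>(5)[OF x] by eventually_elim (simp add: f_def F_def x inverse_eq_divide)
  qed
  then have inf: "pointwise_inf_zero X f"
    using F_nonneg by (intro pointwise_inf_zeroI dec) (simp_all add: f_def)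
  have "f k \<in> I" for k
    unfolding f_def
  proof (rule riesz_ideal_dominated[OF I riesz_ideal_scale[OF I bI, of 4]])
    show "continuous_map X euclideanreal (F k)"
      unfolding F_def using riesz_ideal_continuous[OF I bI] \<phi>(1)[of k]
      by (intro continuous_intros) auto
    fix x assume x: "x \<in> topspace X"
    have "2 * b x * \<phi> k x \<le> 2 * b x * 1"
      using b0[OF x] \<phi>(3)[of k x] by (intro mult_left_mono) auto
    then have "F k x \<le> 4 * b x"
      unfolding F_def by linarith
    then show "\<bar>F k x\<bar> \<le> \<bar>(\<lambda>x\<in>topspace X. 4 * b x) x\<bar>"
      using F_nonneg[OF x, of k] x by simp
  qed
  moreover have "\<exists>N. \<forall>n\<ge>N. \<forall>x\<in>topspace X. \<bar>g' x - g n x\<bar> \<le> f k x" for k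
  proof -
    obtain K where K: "compactin X K" "\<And>x. x \<in> topspace X - K \<Longrightarrow> \<phi> k x = 1"
      using \<phi>(6)[of k] by blast
    obtain N where N: "\<And>n x. n \<ge> N \<Longrightarrow> x \<in> K \<Longrightarrow> \<bar>g n x - g' x\<bar> < 1 / real (Suc k)"
      using unif[OF K(1), of "1 / real (Suc k)"] unfolding eventually_sequentially by auto
    have "\<bar>g' x - g n x\<bar> \<le> f k x" if n: "n \<ge> N" and x: "x \<in> topspace X" for n x
    proof (cases "x \<in> K")
      case True
      have "0 \<le> 2 * b x * \<phi> k x"
        using b0[OF x] \<phi>(2)[of k x] by simp
      then show ?thesis
        using N[OF n True] diff[OF x, of n] x unfolding f_def F_def by simp
    next
      case False
      then have "f k x = 2 * b x + min (2 * b x) (1 / real (Suc k))"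
        using K(2)[of x] x by (simp add: f_def F_def)
      moreover have "0 \<le> min (2 * b x) (1 / real (Suc k))"
        using b0[OF x] by simp
      ultimately show ?thesis
        using diff[OF x, of n] by linarith
    qed
    then show ?thesis by blast
  qed
  ultimately show ?thesis
    unfolding strictly_convergent_def using dec inf by blast
qed

theorem corollary3p8:
  fixes X :: "'a topology"
    and I :: "('a \<Rightarrow> real) set"
    and g :: "nat \<Rightarrow> 'a \<Rightarrow> real"
    and g' :: "'a \<Rightarrow> real"
  assumes "topspace X \<noteq> {}"
    and "Lindelof_space X"
    and "locally_compact_space X"
    and "Hausdorff_space X"
    and "riesz_ideal X I"
    and "\<And>n. g n \<in> I"
    and "g' \<in> I"
  shows "strictly_convergent X I g g' \<longleftrightarrow>
         (\<exists>b\<in>nonneg_part X I. \<forall>n. \<forall>x\<in>topspace X. \<bar>g n x\<bar> \<le> b x) \<and>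
         limitin (compact_convergence_topology X) g g' sequentially"
proof
  assume "strictly_convergent X I g g'"
  then show "(\<exists>b\<in>nonneg_part X I. \<forall>n. \<forall>x\<in>topspace X. \<bar>g n x\<bar> \<le> b x) \<and>
         limitin (compact_convergence_topology X) g g' sequentially"
    using strictly_convergent_imp_bounded[of X I g g']
      strictly_convergent_imp_compact_convergence[of X I g g'] assms(5-7) by blast
next
  assume "(\<exists>b\<in>nonneg_part X I. \<forall>n. \<forall>x\<in>topspace X. \<bar>g n x\<bar> \<le> b x) \<and>
         limitin (compact_convergence_topology X) g g' sequentially"
  then show "strictly_convergent X I g g'"
    using bounded_compact_convergence_imp_strictly_convergent[of X I g g'] assms by blast
qed

end
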